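(* Let $(X,\nu,\mathcal{T}_1,\tau_1)$ be a Type 1 computable topological space which satisfies the Markov condition with respect to normed effective sequential closure, i.e. $$\forall x\in X,\ \forall A\subseteq X,\ \big(x\notin A\ \&\ x\in\overline{A}^{+\mathrm{seq},N}\big)\implies A\rightsquigarrow_\nu\{x\},$$ and which satisfies the identification condition between the closure and the normed effective sequential closure for semi-decidable sets, i.e. $\overline{A}=\overline{A}^{+\mathrm{seq},N}$ for every $\nu$-semi-decidable $A\subseteq X$. Let $(Y,\mu,\mathcal{T}_2,\tau_2)$ be a Type 1 computable topological space in which every point has an effective neighborhood basis of co-semi-decidable sets. Then every $(\nu,\mu)$-computable function $f:X\to Y$ is $(\mathcal{T}_1,\mathcal{T}_2)$-continuous.
   Context: A numbering of a set $X$ is a surjection $\nu$ from a subset $\mathrm{dom}(\nu)\subseteq\mathbb{N}$ onto $X$; a subnumbering of $X$ is a numbering of a subset of $X$. If $\nu(n)=x$, $n$ is a $\nu$-name of $x$. $\varphi_0,\varphi_1,\dots$ is a standard enumeration of the partial recursive functions. For numbered sets $(X,\nu),(Y,\mu)$, a map $f:X\to Y$ is $(\nu,\mu)$-computable if there is a partial computable $F$ defined on $\mathrm{dom}(\nu)$ with $\mu(F(n))=f(\nu(n))$ for all $n\in\mathrm{dom}(\nu)$. A set $A\subseteq X$ is $\nu$-semi-decidable if there is $e$ with $\varphi_e(i)\downarrow\iff\nu(i)\in A$ for all $i\in\mathrm{dom}(\nu)$; such $e$ is a $\nu_{SD}$-name of $A$. A set is $\nu$-co-semi-decidable if its complement is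 $\nu$-semi-decidable. For $B\subseteq C\subseteq X$, $B$ is a $\nu$-semi-decidable subset of $C$ if there is $e$ such that for all $i\in\mathrm{dom}(\nu)$ with $\nu(i)\in C$: $\varphi_e(i)\downarrow\iff\nu(i)\in B$. One writes $A\rightsquigarrow_\nu B$ iff $B$ is not a $\nu$-semi-decidable subset of $A\cup B$. For subnumberings $\alpha,\beta$ of a set, $\alpha\le\beta$ means there is a partial computable $F$ defined on $\mathrm{dom}(\alpha)$ with $\beta(F(n))=\alpha(n)$. A sequence $(u_n)$ in $X$ is $\nu$-computable if there is a total computable $g$ with $g(n)\in\mathrm{dom}(\nu)$ and $\nu(g(n))=u_n$ for all $n$. A Type 1 computable topological space is a quadruple $(X,\nu,\mathcal{T},\tau)$ where $\mathcal{T}$ is a topology on $X$, $\nu$ a numbering of $X$, $\tau$ a subnumbering of $\mathcal{T}$, such that: the image of $\tau$ generates $\mathcal{T}$ as a basis; $\emptyset$ and $X$ are in the image of $\tau$; $\tau\le\nu_{SD}$; there is a computable procedure which, given an index of a total computable $g$ with values in $\mathrm{dom}(\tau)$, outputs a $\tau$-name of $\bigcup_n\tau(g(n))$; and there is a computable procedure which from $\tau$-names of $O_1,O_2$ outputs a $\tau$-name of $O_1\cap O_2$. Sets in the image of $\tau$ are the effective open sets. A $\nu$-computable sequence $(u_n)$ converging to $x$ is computably normed if there is a partial computable function which, on input any $\tau$-name of an open set $O$ containing $x$, outputs $N$ with $u_n\in O$ for all $n\ge N$. For $A\subseteq X$, the normed effective sequential closure $\overline{A}^{+\mathrm{seq},N}$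 is the set of limits of computably normed converging $\nu$-computable sequences of elements of $A$; $\overline{A}$ denotes the usual closure. For $x\in X$, let $\mathfrak{n}_x$ be the multi-numbering of neighborhoods of $x$: its names are the $\tau$-names $n$ with $x\in\tau(n)$, and $n$ names every set $A\supseteq\tau(n)$. An effective neighborhood basis of $x$ is a pair $(\mathcal{B}_x,\beta_x)$ with $\mathcal{B}_x$ a neighborhood basis of $x$ and $\beta_x$ a numbering of $\mathcal{B}_x$, such that there is a computable procedure which, given any $\mathfrak{n}_x$-name $n$, produces a $\beta_x$-name of some $B\in\mathcal{B}_x$ with $B\subseteq\tau(n)$. The point $x$ has an effective neighborhood basis of co-semi-decidable sets if there is such a pair in which every $\beta_x(n)$ is co-semi-decidable for the numbering of the space. *)

theory Defs
  imports "HOL-Analysis.Analysis" "HOL-Library.Nat_Bijection"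
begin

text \<open>
  Unary partial recursive functions are generated from zero, successor and the projections of the
  Cantor pairing function by pairing, composition, primitive recursion and unbounded minimisation.
  Functions of several arguments are handled through \<^const>\<open>prod_encode\<close>.
\<close>

datatype recf =
    Zero
  | Succ
  | Proj1
  | Proj2
  | Pairing recf recf
  | Comp recf recf
  | PrimRec recf recf
  | Mu recf

primrec eval :: "recf \<Rightarrow> nat \<rightharpoonup> nat" where
  "eval Zero n = Some 0"
| "eval Succ n = Some (Suc n)"
| "eval Proj1 n = Some (fst (prod_decode n))"
| "eval Proj2 n = Some (snd (prod_decode n))"
| "eval (Pairing c d) n =
     Option.bind (eval c n) (\<lambda>a. Option.bind (eval d n) (\<lambda>b. Some (prod_encode (a, b))))"
| "eval (Comp c d) n = Option.bind (eval d n) (eval c)"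
| "eval (PrimRec c d) n =
     (case prod_decode n of (a, k) \<Rightarrow>
        rec_nat (eval c a)
          (\<lambda>j r. Option.bind r (\<lambda>b. eval d (prod_encode (a, prod_encode (j, b))))) k)"
| "eval (Mu c) n =
     (let P = (\<lambda>m. eval c (prod_encode (n, m)) = Some 0 \<and>
                   (\<forall>j<m. eval c (prod_encode (n, j)) \<noteq> None))
      in if \<exists>m. P m then Some (LEAST m. P m) else None)"

lemma fst_prod_decode_le: "fst (prod_decode m) \<le> m"
  using le_prod_encode_1[of "fst (prod_decode m)" "snd (prod_decode m)"] by simp

lemma snd_prod_decode_le: "snd (prod_decode m) \<le> m"
  using le_prod_encode_2[of "snd (prod_decode m)" "fst (prod_decode m)"] by simp

function decode :: "nat \<Rightarrow> recf" where
  "decode n =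
     (if n = 0 then Zero
      else if n = 1 then Succ
      else if n = 2 then Proj1
      else if n = 3 then Proj2
      else let m = (n - 4) div 4; a = fst (prod_decode m); b = snd (prod_decode m) in
        (if (n - 4) mod 4 = 0 then Pairing (decode a) (decode b)
         else if (n - 4) mod 4 = 1 then Comp (decode a) (decode b)
         else if (n - 4) mod 4 = 2 then PrimRec (decode a) (decode b)
         else Mu (decode m)))"
  by auto
termination
proof (relation "Wellfounded.measure id", goal_cases)
  case 1
  show ?case by simp
next
  have fst_less: "fst (prod_decode ((n - 4) div 4)) < n" if "n \<noteq> 0" for n
    using that fst_prod_decode_le[of "(n - 4) div 4"] by linarith
  have snd_less: "snd (prod_decode ((n - 4) div 4)) < n" if "n \<noteq> 0" for n
    using that snd_prod_decode_le[of "(n - 4) div 4"] by linarith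
  have div_less: "(n - 4) div 4 < n" if "n \<noteq> 0" for n :: nat
    using that by linarith
  {
    case 2 then show ?case using fst_less by simp
  next
    case 3 then show ?case using snd_less by simp
  next
    case 4 then show ?case using fst_less by simp
  next
    case 5 then show ?case using snd_less by simp
  next
    case 6 then show ?case using fst_less by simp
  next
    case 7 then show ?case using snd_less by simp
  next
    case 8 then show ?case using div_less by simp
  }
qed

declare decode.simps [simp del]

primrec encode :: "recf \<Rightarrow> nat" where
  "encode Zero = 0"
| "encode Succ = 1"
| "encode Proj1 = 2"
| "encode Proj2 = 3"
| "encode (Pairing c d) = 4 * prod_encode (encode c, encode d) + 4"
| "encode (Comp c d) = 4 * prod_encode (encode c, encode d) + 5"
| "encode (PrimRec c d) = 4 * prod_encode (encode c, encode d) + 6"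
| "encode (Mu c) = 4 * encode c + 7"

lemma decode_encode: "decode (encode c) = c"
proof (induction c)
  case (Pairing c d)
  then show ?case by (subst decode.simps) simp
next
  case (Comp c d)
  have "(4 * m + 1) div 4 = m" "(4 * m + 1) mod 4 = 1" for m :: nat
    by presburger+
  with Comp show ?case by (subst decode.simps) simp
next
  case (PrimRec c d)
  have "(4 * m + 2) div 4 = m" "(4 * m + 2) mod 4 = 2" for m :: nat
    by presburger+
  with PrimRec show ?case by (subst decode.simps) simp
next
  case (Mu c)
  have "(4 * m + 3) div 4 = m" "(4 * m + 3) mod 4 = 3" for m :: nat
    by presburger+
  with Mu show ?case by (subst decode.simps) simp
qed (simp_all add: decode.simps[of 0] decode.simps[of 1] decode.simps[of "Suc 0"] decode.simps[of 2] decode.simps[of 3])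

definition phi :: "nat \<Rightarrow> nat \<rightharpoonup> nat" where
  "phi e = eval (decode e)"

definition partial_computable :: "(nat \<rightharpoonup> nat) \<Rightarrow> bool" where
  "partial_computable F \<longleftrightarrow> (\<exists>e. F = phi e)"

lemma partial_computable_iff_eval: "partial_computable F \<longleftrightarrow> (\<exists>c. F = eval c)"
  unfolding partial_computable_def phi_def by (metis decode_encode)

text \<open>
  A numbering is a partial map from \<^typ>\<open>nat\<close>; \<^term>\<open>dom \<nu>\<close> is the set of names.
\<close>

definition numbering :: "'a set \<Rightarrow> (nat \<rightharpoonup> 'a) \<Rightarrow> bool" where
  "numbering X \<nu> \<longleftrightarrow> ran \<nu> = X"

definition subnumbering :: "'a set \<Rightarrow> (nat \<rightharpoonup> 'a) \<Rightarrow> bool" where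
  "subnumbering X \<nu> \<longleftrightarrow> (\<exists>S\<subseteq>X. numbering S \<nu>)"

definition reducible :: "(nat \<rightharpoonup> 'a) \<Rightarrow> (nat \<rightharpoonup> 'a) \<Rightarrow> bool" where
  "reducible \<alpha> \<beta> \<longleftrightarrow>
     (\<exists>F. partial_computable F \<and>
        (\<forall>n\<in>dom \<alpha>. \<exists>m. F n = Some m \<and> m \<in> dom \<beta> \<and> \<beta> m = \<alpha> n))"

definition computable_fun :: "(nat \<rightharpoonup> 'a) \<Rightarrow> (nat \<rightharpoonup> 'b) \<Rightarrow> ('a \<Rightarrow> 'b) \<Rightarrow> bool" where
  "computable_fun \<nu> \<mu> f \<longleftrightarrow>
     (\<exists>F. partial_computable F \<and>
        (\<forall>n\<in>dom \<nu>. \<exists>m. F n = Some m \<and> \<mu> m = Some (f (the (\<nu> n)))))"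

definition computable_seq :: "(nat \<rightharpoonup> 'a) \<Rightarrow> (nat \<Rightarrow> 'a) \<Rightarrow> bool" where
  "computable_seq \<nu> u \<longleftrightarrow>
     (\<exists>g. partial_computable g \<and> (\<forall>n. \<exists>k. g n = Some k \<and> \<nu> k = Some (u n)))"

text \<open>In the following definitions the numbered set is \<^term>\<open>ran \<nu>\<close>.\<close>

definition sd_name :: "(nat \<rightharpoonup> 'a) \<Rightarrow> nat \<Rightarrow> 'a set \<Rightarrow> bool" where
  "sd_name \<nu> e A \<longleftrightarrow>
     A \<subseteq> ran \<nu> \<and> (\<forall>i\<in>dom \<nu>. i \<in> dom (phi e) \<longleftrightarrow> the (\<nu> i) \<in> A)"

definition semi_decidable :: "(nat \<rightharpoonup> 'a) \<Rightarrow> 'a set \<Rightarrow> bool" where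
  "semi_decidable \<nu> A \<longleftrightarrow> (\<exists>e. sd_name \<nu> e A)"

definition co_semi_decidable :: "(nat \<rightharpoonup> 'a) \<Rightarrow> 'a set \<Rightarrow> bool" where
  "co_semi_decidable \<nu> A \<longleftrightarrow> A \<subseteq> ran \<nu> \<and> semi_decidable \<nu> (ran \<nu> - A)"

lemma sd_name_unique:
  assumes "sd_name \<nu> e A" "sd_name \<nu> e B"
  shows "A = B"
proof -
  have "x \<in> A \<longleftrightarrow> x \<in> B" if "x \<in> ran \<nu>" for x
  proof -
    from that obtain i where "\<nu> i = Some x" by (auto simp: ran_def)
    with assms show ?thesis unfolding sd_name_def by (metis domI option.sel)
  qed
  with assms show ?thesis unfolding sd_name_def by blast
qed

definition sd_numbering :: "(nat \<rightharpoonup> 'a) \<Rightarrow> (nat \<rightharpoonup> 'a set)" where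
  "sd_numbering \<nu> e =
     (if \<exists>A. sd_name \<nu> e A then Some (THE A. sd_name \<nu> e A) else None)"

lemma sd_numbering_eq_Some_iff: "sd_numbering \<nu> e = Some A \<longleftrightarrow> sd_name \<nu> e A"
proof
  assume eq: "sd_numbering \<nu> e = Some A"
  then obtain B where B: "sd_name \<nu> e B"
    unfolding sd_numbering_def by (metis option.distinct(1))
  then have "(THE A. sd_name \<nu> e A) = B"
    using sd_name_unique by (metis the_equality)
  with eq B show "sd_name \<nu> e A"
    unfolding sd_numbering_def by (metis option.sel)
next
  assume A: "sd_name \<nu> e A"
  then have "(THE A. sd_name \<nu> e A) = A"
    using sd_name_unique by (metis the_equality)
  with A show "sd_numbering \<nu> e = Some A"
    unfolding sd_numbering_def by metis
qed

definition semi_decidable_subset :: "(nat \<rightharpoonup> 'a) \<Rightarrow> 'a set \<Rightarrow> 'a set \<Rightarrow> bool" where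
  "semi_decidable_subset \<nu> B C \<longleftrightarrow>
     B \<subseteq> C \<and> C \<subseteq> ran \<nu> \<and>
     (\<exists>e. \<forall>i\<in>dom \<nu>. the (\<nu> i) \<in> C \<longrightarrow> (i \<in> dom (phi e) \<longleftrightarrow> the (\<nu> i) \<in> B))"

definition not_semi_decidable_from :: "'a set \<Rightarrow> (nat \<rightharpoonup> 'a) \<Rightarrow> 'a set \<Rightarrow> bool"
    (\<open>(_ \<leadsto>\<^bsub>_\<^esub> _)\<close> [51, 0, 51] 50) where
  "A \<leadsto>\<^bsub>\<nu>\<^esub> B \<longleftrightarrow> \<not> semi_decidable_subset \<nu> B (A \<union> B)"

text \<open>The underlying set of the space is \<^term>\<open>topspace T\<close>.\<close>

definition type1_space :: "(nat \<rightharpoonup> 'a) \<Rightarrow> 'a topology \<Rightarrow> (nat \<rightharpoonup> 'a set) \<Rightarrow> bool" where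
  "type1_space \<nu> T \<tau> \<longleftrightarrow>
     numbering (topspace T) \<nu> \<and>
     subnumbering {U. openin T U} \<tau> \<and>
     openin T = arbitrary union_of (\<lambda>U. U \<in> ran \<tau>) \<and>
     {} \<in> ran \<tau> \<and> topspace T \<in> ran \<tau> \<and>
     reducible \<tau> (sd_numbering \<nu>) \<and>
     (\<exists>F. partial_computable F \<and>
        (\<forall>e. (\<forall>n. \<exists>k. phi e n = Some k \<and> k \<in> dom \<tau>) \<longrightarrow>
           (\<exists>m. F e = Some m \<and> \<tau> m = Some (\<Union>n. the (\<tau> (the (phi e n))))))) \<and>
     (\<exists>F. partial_computable F \<and>
        (\<forall>a\<in>dom \<tau>. \<forall>b\<in>dom \<tau>.
           \<exists>m. F (prod_encode (a, b)) = Some m \<and> \<tau> m = Some (the (\<tau> a) \<inter> the (\<tau> b))))"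

definition computably_normed :: "(nat \<rightharpoonup> 'a set) \<Rightarrow> (nat \<Rightarrow> 'a) \<Rightarrow> 'a \<Rightarrow> bool" where
  "computably_normed \<tau> u x \<longleftrightarrow>
     (\<exists>F. partial_computable F \<and>
        (\<forall>k\<in>dom \<tau>. x \<in> the (\<tau> k) \<longrightarrow>
           (\<exists>N. F k = Some N \<and> (\<forall>n\<ge>N. u n \<in> the (\<tau> k)))))"

definition normed_seq_closure ::
    "(nat \<rightharpoonup> 'a) \<Rightarrow> 'a topology \<Rightarrow> (nat \<rightharpoonup> 'a set) \<Rightarrow> 'a set \<Rightarrow> 'a set" where
  "normed_seq_closure \<nu> T \<tau> A =
     {x. \<exists>u. computable_seq \<nu> u \<and> range u \<subseteq> A \<and> limitin T u x sequentially \<and>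
             computably_normed \<tau> u x}"

text \<open>Multi-numberings are given as relations between names and objects.\<close>

definition nbhd_multinumbering ::
    "'a topology \<Rightarrow> (nat \<rightharpoonup> 'a set) \<Rightarrow> 'a \<Rightarrow> (nat \<times> 'a set) set" where
  "nbhd_multinumbering T \<tau> x =
     {(n, A). n \<in> dom \<tau> \<and> x \<in> the (\<tau> n) \<and> the (\<tau> n) \<subseteq> A \<and> A \<subseteq> topspace T}"

definition nbhd_basis :: "'a topology \<Rightarrow> 'a \<Rightarrow> 'a set set \<Rightarrow> bool" where
  "nbhd_basis T x \<B> \<longleftrightarrow>
     (\<forall>B\<in>\<B>. B \<subseteq> topspace T \<and> (\<exists>U. openin T U \<and> x \<in> U \<and> U \<subseteq> B)) \<and>
     (\<forall>U. openin T U \<and> x \<in> U \<longrightarrow> (\<exists>B\<in>\<B>. B \<subseteq> U))"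

definition effective_nbhd_basis ::
    "'a topology \<Rightarrow> (nat \<rightharpoonup> 'a set) \<Rightarrow> 'a \<Rightarrow> 'a set set \<Rightarrow> (nat \<rightharpoonup> 'a set) \<Rightarrow> bool" where
  "effective_nbhd_basis T \<tau> x \<B> \<beta> \<longleftrightarrow>
     nbhd_basis T x \<B> \<and> numbering \<B> \<beta> \<and>
     (\<exists>F. partial_computable F \<and>
        (\<forall>n\<in>Domain (nbhd_multinumbering T \<tau> x).
           \<exists>m B. F n = Some m \<and> \<beta> m = Some B \<and> B \<subseteq> the (\<tau> n)))"

definition has_co_semi_decidable_nbhd_basis ::
    "(nat \<rightharpoonup> 'a) \<Rightarrow> 'a topology \<Rightarrow> (nat \<rightharpoonup> 'a set) \<Rightarrow> 'a \<Rightarrow> bool" where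
  "has_co_semi_decidable_nbhd_basis \<nu> T \<tau> x \<longleftrightarrow>
     (\<exists>\<B> \<beta>. effective_nbhd_basis T \<tau> x \<B> \<beta> \<and>
        (\<forall>n\<in>dom \<beta>. co_semi_decidable \<nu> (the (\<beta> n))))"

end

(*
  Let y = f x, let B be a co-semi-decidable neighborhood of y inside a given open set, and let
  A = f\<^sup>-\<^sup>1(Y - B), which is semi-decidable. If x were in the closure of A, then by the
  identification condition and the Markov condition {x} would not be semi-decidable in A \<union> {x}.
  But an effective open W with y \<in> W \<subseteq> B is semi-decidable, and its preimage separates x from A.
  So x has a neighborhood that misses A, and f maps it into B.
*)
theory Submission
  imports Defs
begin

text \<open>Chain the two programs: one realizing \<open>f\<close> turns each name of a point
  \<open>z\<close> into a \<open>\<mu>\<close>-name of \<open>f z\<close>, and the program for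
  \<open>B\<close> halts there exactly when \<open>f z\<close> lies in \<open>B\<close>.\<close>

lemma semi_decidable_vimage:
  assumes "computable_fun \<nu> \<mu> f" "semi_decidable \<mu> B"
  shows "semi_decidable \<nu> {x \<in> ran \<nu>. f x \<in> B}"
proof -
  obtain c where c: "\<forall>n\<in>dom \<nu>. \<exists>m. eval c n = Some m \<and> \<mu> m = Some (f (the (\<nu> n)))"
    using assms(1) unfolding computable_fun_def partial_computable_iff_eval by blast
  obtain e where e: "sd_name \<mu> e B"
    using assms(2) unfolding semi_decidable_def by blast
  have "i \<in> dom (phi (encode (Comp (decode e) c))) \<longleftrightarrow> the (\<nu> i) \<in> {x \<in> ran \<nu>. f x \<in> B}"
    if i: "i \<in> dom \<nu>" for i
  proof -
    obtain m where m: "eval c i = Some m" "\<mu> m = Some (f (the (\<nu> i)))"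
      using c i by blast
    have "m \<in> dom (phi e) \<longleftrightarrow> f (the (\<nu> i)) \<in> B"
      using e m(2) unfolding sd_name_def by (metis domI option.sel)
    moreover have "the (\<nu> i) \<in> ran \<nu>"
      using i by (auto simp: ran_def)
    ultimately show ?thesis
      \<comment> \<open>The index must stay in the form \<open>encode (Comp ...)\<close> for
        \<open>decode_encode\<close> to rewrite it, so \<open>encode.simps\<close> is kept from
        unfolding it.\<close>
      using m(1) by (simp add: phi_def decode_encode dom_def del: encode.simps)
  qed
  then show ?thesis
    unfolding semi_decidable_def sd_name_def by blast
qed

lemma type1_space_ran: "type1_space \<nu> T \<tau> \<Longrightarrow> ran \<nu> = topspace T"
  by (simp add: type1_space_def numbering_def)

text \<open>The reduction of \<open>\<tau>\<close> to \<open>sd_numbering \<nu>\<close> sends a name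
  of \<open>U\<close> to the index of a program semi-deciding \<open>U\<close>.\<close>

lemma semi_decidable_effective_open:
  assumes "type1_space \<nu> T \<tau>" "U \<in> ran \<tau>"
  shows "semi_decidable \<nu> U"
proof -
  obtain n where n: "\<tau> n = Some U"
    using assms(2) by (auto simp: ran_def)
  have "reducible \<tau> (sd_numbering \<nu>)"
    using assms(1) unfolding type1_space_def by (elim conjE)
  then obtain m where "sd_numbering \<nu> m = Some U"
    using n unfolding reducible_def by (metis domI)
  then show ?thesis
    unfolding semi_decidable_def sd_numbering_eq_Some_iff by blast
qed

lemma effective_open_basis:
  assumes "type1_space \<nu> T \<tau>" "openin T U" "x \<in> U"
  obtains W where "W \<in> ran \<tau>" "x \<in> W" "W \<subseteq> U"
proof -
  have "openin T = arbitrary union_of (\<lambda>U. U \<in> ran \<tau>)"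
    using assms(1) unfolding type1_space_def by (elim conjE)
  then have "(arbitrary union_of (\<lambda>U. U \<in> ran \<tau>)) U"
    using assms(2) by simp
  then show thesis
    using assms(3) that unfolding union_of_def arbitrary_def by blast
qed

text \<open>Serves to refute \<open>\<leadsto>\<close>: a semi-decidable set that cuts
  \<open>A \<union> {x}\<close> down to \<open>{x}\<close> suffices.\<close>

lemma semi_decidable_subset_Int:
  assumes "semi_decidable \<nu> S" "C \<subseteq> ran \<nu>"
  shows "semi_decidable_subset \<nu> (S \<inter> C) C"
  using assms unfolding semi_decidable_def sd_name_def semi_decidable_subset_def by blast

lemma co_semi_decidable_nbhd:
  assumes "has_co_semi_decidable_nbhd_basis \<mu> T \<tau> y" "openin T V" "y \<in> V"
  obtains B U where "co_semi_decidable \<mu> B" "B \<subseteq> V" "openin T U" "y \<in> U" "U \<subseteq> B"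
proof -
  obtain \<B> \<beta> where b: "nbhd_basis T y \<B>" "numbering \<B> \<beta>"
      and co: "\<forall>n\<in>dom \<beta>. co_semi_decidable \<mu> (the (\<beta> n))"
    using assms(1) unfolding has_co_semi_decidable_nbhd_basis_def effective_nbhd_basis_def
    by blast
  obtain B where B: "B \<in> \<B>" "B \<subseteq> V"
    using b(1) assms(2,3) unfolding nbhd_basis_def by blast
  obtain n where "\<beta> n = Some B"
    using B(1) b(2) by (auto simp: numbering_def ran_def)
  then have "co_semi_decidable \<mu> B"
    using bspec[OF co, of n] by auto
  then show thesis
    using that B b(1) unfolding nbhd_basis_def by meson
qed

theorem mainTheorem3:
  fixes \<nu> :: "nat \<rightharpoonup> 'a" and T1 :: "'a topology" and \<tau>1 :: "nat \<rightharpoonup> 'a set"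
    and \<mu> :: "nat \<rightharpoonup> 'b" and T2 :: "'b topology" and \<tau>2 :: "nat \<rightharpoonup> 'b set"
    and f :: "'a \<Rightarrow> 'b"
  assumes "type1_space \<nu> T1 \<tau>1"
    and Markov: "\<forall>x\<in>topspace T1. \<forall>A\<subseteq>topspace T1.
      x \<notin> A \<and> x \<in> normed_seq_closure \<nu> T1 \<tau>1 A \<longrightarrow> A \<leadsto>\<^bsub>\<nu>\<^esub> {x}"
    and identification: "\<forall>A\<subseteq>topspace T1.
      semi_decidable \<nu> A \<longrightarrow> T1 closure_of A = normed_seq_closure \<nu> T1 \<tau>1 A"
    and "type1_space \<mu> T2 \<tau>2"
    and "\<forall>y\<in>topspace T2. has_co_semi_decidable_nbhd_basis \<mu> T2 \<tau>2 y"
    and "f \<in> topspace T1 \<rightarrow> topspace T2"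
    and "computable_fun \<nu> \<mu> f"
  shows "continuous_map T1 T2 f"
proof -
  note ran = type1_space_ran[OF assms(1)] type1_space_ran[OF assms(4)]
  have nbhd: "\<exists>G. openin T1 G \<and> x \<in> G \<and> G \<subseteq> {x \<in> topspace T1. f x \<in> V}"
    if V: "openin T2 V" and x: "x \<in> topspace T1" "f x \<in> V" for V x
  proof -
    have "f x \<in> topspace T2"
      using assms(6) x(1) by blast
    then obtain B U where B: "co_semi_decidable \<mu> B" "B \<subseteq> V"
        and U: "openin T2 U" "f x \<in> U" "U \<subseteq> B"
      using co_semi_decidable_nbhd V x(2) assms(5) by metis
    \<comment> \<open>\<open>U\<close> is merely open; shrinking it to a basic set in
      \<open>ran \<tau>2\<close> yields semi-decidability.\<close>
    obtain W where W: "W \<in> ran \<tau>2" "f x \<in> W" "W \<subseteq> U"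
      using effective_open_basis[OF assms(4) U(1,2)] .
    define A where "A = {z \<in> ran \<nu>. f z \<in> ran \<mu> - B}"
    have A: "semi_decidable \<nu> A"
      using semi_decidable_vimage[OF assms(7)] B(1) unfolding A_def co_semi_decidable_def by blast
    have A_sub: "A \<subseteq> topspace T1" and x_A: "x \<notin> A"
      using ran W U by (auto simp: A_def)
    have "x \<notin> T1 closure_of A"
    proof
      assume "x \<in> T1 closure_of A"
      then have "A \<leadsto>\<^bsub>\<nu>\<^esub> {x}"
        using identification Markov A A_sub x(1) x_A by blast
      \<comment> \<open>\<open>f\<close> sends \<open>A\<close> outside \<open>B\<close>, hence
        outside \<open>W\<close>, while \<open>f x\<close> lies in \<open>W\<close>.\<close>
      moreover have "{z \<in> ran \<nu>. f z \<in> W} \<inter> (A \<union> {x}) = {x}"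
        using W U x(1) ran by (auto simp: A_def)
      moreover have "semi_decidable \<nu> {z \<in> ran \<nu>. f z \<in> W}"
        using semi_decidable_vimage[OF assms(7) semi_decidable_effective_open[OF assms(4) W(1)]] .
      ultimately show False
        using semi_decidable_subset_Int[of \<nu> "{z \<in> ran \<nu>. f z \<in> W}" "A \<union> {x}"] A_sub x(1) ran
        unfolding not_semi_decidable_from_def by auto
    qed
    \<comment> \<open>The left side is the neighborhood \<open>G\<close> sought. Its points avoid
      \<open>A\<close>, and their images lie in \<open>ran \<mu>\<close>, hence in \<open>B\<close>,
      which is contained in \<open>V\<close>.\<close>
    moreover have "topspace T1 - T1 closure_of A \<subseteq> {x \<in> topspace T1. f x \<in> V}"
      using closure_of_subset[OF A_sub] ran assms(6) B(2) by (auto simp: A_def)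
    ultimately show ?thesis
      using x(1) by (blast intro: closedin_closure_of)
  qed
  have "openin T1 {x \<in> topspace T1. f x \<in> V}" if "openin T2 V" for V
    by (subst openin_subopen) (use nbhd[OF that] in blast)
  then show ?thesis
    using assms(6) by (auto simp: continuous_map)
qed

end
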